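(* Let $H$ be a real Hilbert space, let $C\subseteq H$ be a nonempty, bounded, closed and convex set, let $b\in[0,\infty)$, and let $T:C\to C$ be a $b$-enriched nonexpansive and demicompact mapping. Then the set $Fix(T)$ of fixed points of $T$ is a nonempty convex set, and there exists $\lambda\in(0,1)$ such that, for any given $x_0\in C$, the sequence $\{x_n\}_{n=0}^{\infty}$ given by $$x_{n+1}=(1-\lambda)x_n+\lambda Tx_n,\qquad n\geq 0,$$ converges strongly (i.e. in norm) to a fixed point of $T$.
   Context: Let $H$ be a real Hilbert space with norm $\|\cdot\|$ and $C\subseteq H$. For $T:C\to C$, $Fix(T)=\{x\in C: Tx=x\}$. For $b\in[0,\infty)$, a mapping $T:C\to C$ is called $b$-enriched nonexpansive if $$\|b(x-y)+Tx-Ty\|\leq (b+1)\|x-y\|\quad\text{for all }x,y\in C.$$ A mapping $T:C\to H$ is called demicompact if, whenever $\{u_n\}$ is a bounded sequence in $C$ such that $\{Tu_n-u_n\}$ is strongly convergent, there exists a subsequence $\{u_{n_k}\}$ of $\{u_n\}$ which is strongly convergent. *)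

theory Defs
  imports "HOL-Analysis.Analysis"
begin

text \<open>
  A mapping with domain C is represented by a total function of which only the
  values on C matter; that it maps C into itself is a separate hypothesis.
\<close>

definition Fix_on :: "'a set \<Rightarrow> ('a \<Rightarrow> 'a) \<Rightarrow> 'a set" where
  "Fix_on C T = {x \<in> C. T x = x}"

definition enriched_nonexpansive_on ::
    "real \<Rightarrow> 'a::real_normed_vector set \<Rightarrow> ('a \<Rightarrow> 'a) \<Rightarrow> bool" where
  "enriched_nonexpansive_on b C T \<longleftrightarrow>
     (\<forall>x\<in>C. \<forall>y\<in>C. norm (b *\<^sub>R (x - y) + T x - T y) \<le> (b + 1) * norm (x - y))"

definition demicompact_on :: "'a::real_normed_vector set \<Rightarrow> ('a \<Rightarrow> 'a) \<Rightarrow> bool" where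
  "demicompact_on C T \<longleftrightarrow>
     (\<forall>u :: nat \<Rightarrow> 'a.
        range u \<subseteq> C \<and> bounded (range u) \<and> convergent (\<lambda>n. T (u n) - u n) \<longrightarrow>
        (\<exists>r :: nat \<Rightarrow> nat. strict_mono r \<and> convergent (u \<circ> r)))"

end

theory Submission
  imports Defs
begin

text \<open>
  The average \<open>S x = (b x + T x) / (b + 1)\<close> turns enrichment into ordinary nonexpansiveness:
  the enriched inequality for \<open>T\<close>, divided by \<open>b + 1\<close>, says that \<open>S\<close> is nonexpansive.
  Because \<open>T x - x = (b + 1) (S x - x)\<close>, the maps \<open>S\<close> and \<open>T\<close> have the same fixed points and
  the same approximate fixed point sequences, and the iteration of \<open>T\<close> with parameter
  \<open>1 / (2 (b + 1))\<close> is the iteration \<open>x \<mapsto> (x + S x) / 2\<close>.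

  Two ideas then carry the proof. The first is compactness: by demicompactness and continuity of
  \<open>S\<close>, every sequence in \<open>C\<close> along which \<open>S u - u \<longlonglongrightarrow> 0\<close> accumulates at a fixed point
  (\<open>approximate_fixed_points_accumulate\<close>). Fixed points of the contractions
  \<open>(1 - t) S + t z\<close> with \<open>t \<rightarrow> 0\<close> provide such a sequence, whence a fixed point exists.

  The second is the identity for \<open>\<parallel>(1 - t) a + t c\<parallel>\<^sup>2\<close> in an inner product space. It makes the
  fixed point set convex, and it shows that each step of the iteration decreases the squared
  distance to any fixed point by at least \<open>\<parallel>S x - x\<parallel>\<^sup>2 / 4\<close>. So these residuals tend to \<open>0\<close>, a
  subsequence of the iterates converges to a fixed point \<open>q\<close>, and the whole sequence follows
  since its distance to \<open>q\<close> never increases.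
\<close>

section \<open>Fixed points of nonexpansive maps\<close>

lemma norm_convex_combination_sq:
  fixes a c :: "'a::real_inner"
  shows "(norm ((1 - t) *\<^sub>R a + t *\<^sub>R c))\<^sup>2
    = (1 - t) * (norm a)\<^sup>2 + t * (norm c)\<^sup>2 - t * (1 - t) * (norm (a - c))\<^sup>2"
  by (simp add: power2_norm_eq_inner inner_simps inner_commute algebra_simps)

text \<open>
  Both fixed points are at least as close to \<open>S z\<close> as to the point \<open>z\<close> between them, and by the
  identity above only \<open>z\<close> itself satisfies both bounds.
\<close>

lemma convex_Fix_on_nonexpansive:
  fixes S :: "'a::real_inner \<Rightarrow> 'a"
  assumes "convex C" and S: "1-lipschitz_on C S"
  shows "convex (Fix_on C S)"
proof (rule convexI)
  fix p q :: 'a and s t :: real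
  assume p: "p \<in> Fix_on C S" and q: "q \<in> Fix_on C S" and st: "0 \<le> s" "0 \<le> t" "s + t = 1"
  define z where "z = s *\<^sub>R p + t *\<^sub>R q"
  have s: "s = 1 - t" using st by simp
  have C: "p \<in> C" "q \<in> C" "S p = p" "S q = q" using p q by (auto simp: Fix_on_def)
  have z: "z \<in> C" unfolding z_def using \<open>convex C\<close> C st by (simp add: convexD)
  have le: "norm (S z - w) \<le> norm (z - w)" if "w \<in> C" "S w = w" for w
    using lipschitz_onD[OF S z that(1)] that(2) by (simp add: dist_norm)
  have expand: "(norm (y - z))\<^sup>2 = (1 - t) * (norm (y - p))\<^sup>2 + t * (norm (y - q))\<^sup>2
      - t * (1 - t) * (norm (q - p))\<^sup>2" for y
    using norm_convex_combination_sq[of t "y - p" "y - q"]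
    by (simp add: z_def s algebra_simps)
  have "(norm (S z - z))\<^sup>2 \<le> (norm (z - z))\<^sup>2"
    unfolding expand using st s C le
    by (intro diff_right_mono add_mono mult_left_mono power_mono) auto
  then have "S z = z" by simp
  with z show "s *\<^sub>R p + t *\<^sub>R q \<in> Fix_on C S" by (simp add: Fix_on_def z_def)
qed

text \<open>
  Contracting towards a point \<open>z\<close> of \<open>C\<close> with ratio \<open>1 - t\<close> makes Banach's theorem applicable;
  at the resulting fixed point \<open>u\<close> one has \<open>S u - u = t (S u - z)\<close>, which is small because
  \<open>C\<close> is bounded.
\<close>

lemma nonexpansive_approximate_fixed_points:
  fixes S :: "'a::banach \<Rightarrow> 'a"
  assumes "C \<noteq> {}" and "bounded C" and "closed C" and "convex C"
    and SC: "S \<in> C \<rightarrow> C" and S: "1-lipschitz_on C S"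
  obtains u :: "nat \<Rightarrow> 'a" where "range u \<subseteq> C" and "(\<lambda>n. S (u n) - u n) \<longlonglongrightarrow> 0"
proof -
  obtain z where z: "z \<in> C" using \<open>C \<noteq> {}\<close> by auto
  define t :: "nat \<Rightarrow> real" where "t n = inverse (real (Suc n))" for n
  have t: "0 < t n" "t n \<le> 1" for n by (auto simp: t_def field_simps)
  have "\<exists>u. u \<in> C \<and> t n *\<^sub>R z + (1 - t n) *\<^sub>R S u = u" for n
  proof -
    let ?f = "\<lambda>u. t n *\<^sub>R z + (1 - t n) *\<^sub>R S u"
    have "\<exists>!u\<in>C. ?f u = u"
    proof (rule Banach_fix)
      show "complete C" using \<open>closed C\<close> by (simp add: complete_eq_closed)
      show "?f ` C \<subseteq> C"
      proof (intro image_subsetI)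
        fix u assume "u \<in> C"
        then have "S u \<in> C" using SC by auto
        then show "?f u \<in> C" using convexD[OF \<open>convex C\<close> z] t[of n] by simp
      qed
      show "dist (?f u) (?f v) \<le> (1 - t n) * dist u v" if "u \<in> C" "v \<in> C" for u v
      proof -
        have "?f u - ?f v = (1 - t n) *\<^sub>R (S u - S v)" by (simp add: algebra_simps)
        then have "dist (?f u) (?f v) = (1 - t n) * dist (S u) (S v)"
          using t[of n] by (simp add: dist_norm)
        also have "\<dots> \<le> (1 - t n) * dist u v"
          using lipschitz_onD[OF S that] t[of n] by (intro mult_left_mono) auto
        finally show ?thesis .
      qed
    qed (use t[of n] \<open>C \<noteq> {}\<close> in auto)
    then show ?thesis by auto
  qed
  then obtain u where u: "\<And>n. u n \<in> C" "\<And>n. t n *\<^sub>R z + (1 - t n) *\<^sub>R S (u n) = u n"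
    by metis
  obtain B where B: "\<And>x. x \<in> C \<Longrightarrow> norm x \<le> B"
    using \<open>bounded C\<close> by (auto simp: bounded_iff)
  have "(\<lambda>n. t n *\<^sub>R (S (u n) - z)) \<longlonglongrightarrow> 0"
  proof (rule Lim_null_comparison)
    show "\<forall>\<^sub>F n in sequentially. norm (t n *\<^sub>R (S (u n) - z)) \<le> t n * (2 * B)"
    proof (intro always_eventually allI)
      fix n
      have "S (u n) \<in> C" using SC u by auto
      then have "norm (S (u n) - z) \<le> 2 * B"
        using norm_triangle_ineq4[of "S (u n)" z] B[of "S (u n)"] B[OF z] by linarith
      then show "norm (t n *\<^sub>R (S (u n) - z)) \<le> t n * (2 * B)"
        using t[of n] by (simp add: mult_left_mono)
    qed
    show "(\<lambda>n. t n * (2 * B)) \<longlonglongrightarrow> 0"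
      unfolding t_def using tendsto_mult_left_zero[OF LIMSEQ_inverse_real_of_nat] .
  qed
  moreover have "S (u n) - u n = t n *\<^sub>R (S (u n) - z)" for n
    using u(2)[of n] by (simp add: algebra_simps)
  ultimately have "(\<lambda>n. S (u n) - u n) \<longlonglongrightarrow> 0" by simp
  with u(1) show thesis by (intro that) auto
qed

text \<open>
  Demicompactness yields a convergent subsequence; continuity carries the vanishing residual
  over to its limit.
\<close>

lemma approximate_fixed_points_accumulate:
  fixes S :: "'a::real_normed_vector \<Rightarrow> 'a"
  assumes "bounded C" and "closed C" and S: "1-lipschitz_on C S" and "demicompact_on C S"
    and u: "range u \<subseteq> C" and lim: "(\<lambda>n. S (u n) - u n) \<longlonglongrightarrow> 0"
  obtains r :: "nat \<Rightarrow> nat" and p where "strict_mono r" and "(u \<circ> r) \<longlonglongrightarrow> p" and "p \<in> Fix_on C S"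
proof -
  have "bounded (range u)" using \<open>bounded C\<close> u by (rule bounded_subset)
  moreover have "convergent (\<lambda>n. S (u n) - u n)" using lim by (rule convergentI)
  ultimately obtain r :: "nat \<Rightarrow> nat" and p where r: "strict_mono r" and p: "(u \<circ> r) \<longlonglongrightarrow> p"
    using \<open>demicompact_on C S\<close> u unfolding demicompact_on_def convergent_def by blast
  have inC: "(u \<circ> r) n \<in> C" for n using u by auto
  have pC: "p \<in> C" using closed_sequentially[OF \<open>closed C\<close> _ p] inC by blast
  have "(\<lambda>n. S ((u \<circ> r) n)) \<longlonglongrightarrow> S p"
    using lipschitz_on_continuous_on[OF S] inC pC p
    by (intro continuous_on_tendsto_compose[of C S]) (auto simp: o_def)
  then have "(\<lambda>n. S ((u \<circ> r) n) - (u \<circ> r) n) \<longlonglongrightarrow> S p - p"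
    using p by (rule tendsto_diff)
  moreover have "(\<lambda>n. S ((u \<circ> r) n) - (u \<circ> r) n) \<longlonglongrightarrow> 0"
    using LIMSEQ_subseq_LIMSEQ[OF lim r] by (simp add: o_def)
  ultimately have "S p - p = 0" by (rule LIMSEQ_unique)
  with pC have "p \<in> Fix_on C S" by (simp add: Fix_on_def)
  with r p show thesis by (rule that)
qed

section \<open>Strong convergence of the averaged iteration\<close>

text \<open>
  The strict gain in each averaging step, coming from the last term of the identity for convex
  combinations.
\<close>

lemma averaged_step_toward_fixed_point:
  fixes S :: "'a::real_inner \<Rightarrow> 'a"
  assumes S: "1-lipschitz_on C S" and x: "x \<in> C" and p: "p \<in> Fix_on C S"
  shows "(norm ((1/2) *\<^sub>R x + (1/2) *\<^sub>R S x - p))\<^sup>2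
    \<le> (norm (x - p))\<^sup>2 - (norm (S x - x))\<^sup>2 / 4"
proof -
  have "norm (S x - p) \<le> norm (x - p)"
    using lipschitz_onD[OF S x, of p] p by (simp add: Fix_on_def dist_norm)
  then have closer: "(norm (S x - p))\<^sup>2 \<le> (norm (x - p))\<^sup>2" by (simp add: power_mono)
  have eq: "(1/2) *\<^sub>R x + (1/2) *\<^sub>R S x - p
      = (1 - 1/2) *\<^sub>R (x - p) + (1/2) *\<^sub>R (S x - p)"
    using scaleR_add_left[of "1/2" "1/2" p] by (simp add: algebra_simps)
  have "(norm ((1/2) *\<^sub>R x + (1/2) *\<^sub>R S x - p))\<^sup>2
      = (norm (x - p))\<^sup>2 / 2 + (norm (S x - p))\<^sup>2 / 2 - (norm (S x - x))\<^sup>2 / 4"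
    unfolding eq norm_convex_combination_sq by (simp add: norm_minus_commute[of x "S x"])
  with closer show ?thesis by linarith
qed

lemma averaged_iteration_converges:
  fixes S :: "'a::real_inner \<Rightarrow> 'a"
  assumes "bounded C" and "closed C" and "convex C"
    and SC: "S \<in> C \<rightarrow> C" and S: "1-lipschitz_on C S" and "demicompact_on C S"
    and "Fix_on C S \<noteq> {}"
    and x0: "x 0 \<in> C" and step: "\<And>n. x (Suc n) = (1/2) *\<^sub>R x n + (1/2) *\<^sub>R S (x n)"
  shows "\<exists>q\<in>Fix_on C S. x \<longlonglongrightarrow> q"
proof -
  have xC: "x n \<in> C" for n
  proof (induction n)
    case (Suc n)
    then have "S (x n) \<in> C" using SC by auto
    with Suc show ?case unfolding step by (intro convexD[OF \<open>convex C\<close>]) auto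
  qed (rule x0)
  have gain: "(norm (x (Suc n) - p))\<^sup>2 \<le> (norm (x n - p))\<^sup>2 - (norm (S (x n) - x n))\<^sup>2 / 4"
    if "p \<in> Fix_on C S" for n p
    unfolding step by (rule averaged_step_toward_fixed_point[OF S xC that])
  have dec: "decseq (\<lambda>n. (norm (x n - p))\<^sup>2)" if "p \<in> Fix_on C S" for p
  proof (rule decseq_SucI)
    show "(norm (x (Suc n) - p))\<^sup>2 \<le> (norm (x n - p))\<^sup>2" for n
      using gain[OF that, of n] zero_le_power2[of "norm (S (x n) - x n)"] by linarith
  qed
  obtain p where p: "p \<in> Fix_on C S" using \<open>Fix_on C S \<noteq> {}\<close> by auto
  obtain d where d: "(\<lambda>n. (norm (x n - p))\<^sup>2) \<longlonglongrightarrow> d"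
    using decseq_convergent[OF dec[OF p], of 0] by auto
  \<comment> \<open>The gains are dominated by the increments of a convergent sequence.\<close>
  have "(\<lambda>n. (norm (S (x n) - x n))\<^sup>2) \<longlonglongrightarrow> 0"
  proof (rule Lim_null_comparison)
    have "(\<lambda>n. 4 * ((norm (x n - p))\<^sup>2 - (norm (x (Suc n) - p))\<^sup>2)) \<longlonglongrightarrow> 4 * (d - d)"
      by (intro tendsto_intros d LIMSEQ_Suc[OF d])
    then show "(\<lambda>n. 4 * ((norm (x n - p))\<^sup>2 - (norm (x (Suc n) - p))\<^sup>2)) \<longlonglongrightarrow> 0" by simp
    show "\<forall>\<^sub>F n in sequentially. norm ((norm (S (x n) - x n))\<^sup>2)
        \<le> 4 * ((norm (x n - p))\<^sup>2 - (norm (x (Suc n) - p))\<^sup>2)"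
    proof (intro always_eventually allI)
      show "norm ((norm (S (x n) - x n))\<^sup>2)
          \<le> 4 * ((norm (x n - p))\<^sup>2 - (norm (x (Suc n) - p))\<^sup>2)" for n
        using gain[OF p, of n] by simp
    qed
  qed
  then have "(\<lambda>n. sqrt ((norm (S (x n) - x n))\<^sup>2)) \<longlonglongrightarrow> sqrt 0" by (rule tendsto_real_sqrt)
  then have "(\<lambda>n. S (x n) - x n) \<longlonglongrightarrow> 0" by (simp add: tendsto_norm_zero_cancel)
  then obtain r :: "nat \<Rightarrow> nat" and q
    where r: "strict_mono r" and q: "(x \<circ> r) \<longlonglongrightarrow> q" and qF: "q \<in> Fix_on C S"
    using approximate_fixed_points_accumulate[OF \<open>bounded C\<close> \<open>closed C\<close> S \<open>demicompact_on C S\<close>] xC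
    by (metis image_subsetI)
  \<comment> \<open>The squared distances to \<open>q\<close> converge, and along \<open>r\<close> they tend to \<open>0\<close>.\<close>
  obtain e where e: "(\<lambda>n. (norm (x n - q))\<^sup>2) \<longlonglongrightarrow> e"
    using decseq_convergent[OF dec[OF qF], of 0] by auto
  have "(\<lambda>n. (norm ((x \<circ> r) n - q))\<^sup>2) \<longlonglongrightarrow> (norm (q - q))\<^sup>2"
    by (intro tendsto_intros q)
  moreover have "(\<lambda>n. (norm ((x \<circ> r) n - q))\<^sup>2) \<longlonglongrightarrow> e"
    using LIMSEQ_subseq_LIMSEQ[OF e r] by (simp add: o_def)
  ultimately have "(norm (q - q))\<^sup>2 = e" by (rule LIMSEQ_unique)
  then have "e = 0" by simp
  then have "(\<lambda>n. sqrt ((norm (x n - q))\<^sup>2)) \<longlonglongrightarrow> sqrt 0"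
    using tendsto_real_sqrt[OF e] by simp
  then have "(\<lambda>n. norm (x n - q)) \<longlonglongrightarrow> 0" by simp
  then have "x \<longlonglongrightarrow> q" by (rule LIM_zero_cancel[OF tendsto_norm_zero_cancel])
  with qF show ?thesis by auto
qed

section \<open>Reduction of enriched nonexpansive maps\<close>

definition enriched_average :: "real \<Rightarrow> ('a::real_vector \<Rightarrow> 'a) \<Rightarrow> 'a \<Rightarrow> 'a" where
  "enriched_average b T x = (b / (b + 1)) *\<^sub>R x + (1 / (b + 1)) *\<^sub>R T x"

text \<open>
  Fixed points and demicompactness pass between \<open>T\<close> and its average through this
  proportionality of the residuals.
\<close>

lemma enriched_average_residual:
  assumes "0 \<le> b"
  shows "T x - x = (b + 1) *\<^sub>R (enriched_average b T x - x)"
proof -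
  have "b + 1 \<noteq> 0" using assms by simp
  have "(b + 1) *\<^sub>R enriched_average b T x = b *\<^sub>R x + T x"
    using \<open>b + 1 \<noteq> 0\<close> by (simp add: enriched_average_def scaleR_add_right)
  then show ?thesis by (simp add: algebra_simps)
qed

lemma Fix_on_enriched_average:
  assumes "0 \<le> b"
  shows "Fix_on C (enriched_average b T) = Fix_on C T"
proof -
  have "enriched_average b T x = x \<longleftrightarrow> T x = x" for x
    using enriched_average_residual[OF assms, of T x] assms by (metis add_nonneg_pos
        eq_iff_diff_eq_0 less_irrefl scaleR_eq_0_iff zero_less_one)
  then show ?thesis by (simp add: Fix_on_def)
qed

lemma demicompact_on_enriched_average:
  assumes "0 \<le> b" and "demicompact_on C T"
  shows "demicompact_on C (enriched_average b T)"
  unfolding demicompact_on_def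
proof (intro allI impI)
  fix u :: "nat \<Rightarrow> 'a"
  let ?S = "enriched_average b T"
  assume u: "range u \<subseteq> C \<and> bounded (range u) \<and> convergent (\<lambda>n. ?S (u n) - u n)"
  then obtain d where "(\<lambda>n. ?S (u n) - u n) \<longlonglongrightarrow> d" by (auto simp: convergent_def)
  then have "(\<lambda>n. (b + 1) *\<^sub>R (?S (u n) - u n)) \<longlonglongrightarrow> (b + 1) *\<^sub>R d"
    by (intro tendsto_scaleR tendsto_const)
  then have "convergent (\<lambda>n. T (u n) - u n)"
    unfolding enriched_average_residual[OF \<open>0 \<le> b\<close>, of T, symmetric] by (rule convergentI)
  with u show "\<exists>r :: nat \<Rightarrow> nat. strict_mono r \<and> convergent (u \<circ> r)"
    using \<open>demicompact_on C T\<close> unfolding demicompact_on_def by blast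
qed

lemma enriched_average_self_map:
  assumes "convex C" and "0 \<le> b" and "T \<in> C \<rightarrow> C"
  shows "enriched_average b T \<in> C \<rightarrow> C"
proof
  fix x assume "x \<in> C"
  then show "enriched_average b T x \<in> C"
    unfolding enriched_average_def using assms
    by (intro convexD) (auto simp: field_simps)
qed

lemma enriched_average_nonexpansive:
  assumes "0 \<le> b" and "enriched_nonexpansive_on b C T"
  shows "1-lipschitz_on C (enriched_average b T)"
proof (rule lipschitz_onI)
  fix x y assume xy: "x \<in> C" "y \<in> C"
  let ?S = "enriched_average b T"
  have "?S x - ?S y = (1 / (b + 1)) *\<^sub>R (b *\<^sub>R (x - y) + T x - T y)"
    by (simp add: enriched_average_def algebra_simps)
  then have "norm (?S x - ?S y) = norm (b *\<^sub>R (x - y) + T x - T y) / (b + 1)"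
    using \<open>0 \<le> b\<close> by simp
  also have "\<dots> \<le> norm (x - y)"
    using assms xy by (simp add: enriched_nonexpansive_on_def field_simps)
  finally show "dist (?S x) (?S y) \<le> 1 * dist x y" by (simp add: dist_norm)
qed simp

theorem theorem2:
  fixes C :: "'a::{real_inner, banach} set"
    and T :: "'a \<Rightarrow> 'a"
    and b :: real
  assumes "C \<noteq> {}" and "bounded C" and "closed C" and "convex C"
    and "0 \<le> b"
    and "T \<in> C \<rightarrow> C"
    and "enriched_nonexpansive_on b C T"
    and "demicompact_on C T"
  shows "Fix_on C T \<noteq> {} \<and> convex (Fix_on C T) \<and>
    (\<exists>l::real. 0 < l \<and> l < 1 \<and>
      (\<forall>x0\<in>C. \<forall>x :: nat \<Rightarrow> 'a.
        x 0 = x0 \<and> (\<forall>n. x (Suc n) = (1 - l) *\<^sub>R x n + l *\<^sub>R T (x n)) \<longrightarrow>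
        (\<exists>p\<in>Fix_on C T. x \<longlonglongrightarrow> p)))"
proof -
  define S where "S = enriched_average b T"
  have SC: "S \<in> C \<rightarrow> C"
    unfolding S_def using assms(4-6) by (rule enriched_average_self_map)
  have S: "1-lipschitz_on C S"
    unfolding S_def using assms(5,7) by (rule enriched_average_nonexpansive)
  have demi: "demicompact_on C S"
    unfolding S_def using assms(5,8) by (rule demicompact_on_enriched_average)
  have Fix: "Fix_on C S = Fix_on C T"
    unfolding S_def using assms(5) by (rule Fix_on_enriched_average)
  obtain u where "range u \<subseteq> C" "(\<lambda>n. S (u n) - u n) \<longlonglongrightarrow> 0"
    using nonexpansive_approximate_fixed_points[OF assms(1-4) SC S] .
  then have nonempty: "Fix_on C S \<noteq> {}"
    using approximate_fixed_points_accumulate[OF assms(2,3) S demi] by blast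
  have conv: "convex (Fix_on C S)" using assms(4) S by (rule convex_Fix_on_nonexpansive)
  define l where "l = 1 / (2 * (b + 1))"
  have l: "0 < l" "l < 1" using \<open>0 \<le> b\<close> by (auto simp: l_def field_simps)
  have iter: "(1 - l) *\<^sub>R y + l *\<^sub>R T y = (1/2) *\<^sub>R y + (1/2) *\<^sub>R S y" for y
  proof -
    have "(1 - l) *\<^sub>R y + l *\<^sub>R T y = y + l *\<^sub>R (T y - y)" by (simp add: algebra_simps)
    also have "\<dots> = y + (l * (b + 1)) *\<^sub>R (S y - y)"
      by (simp add: enriched_average_residual[OF \<open>0 \<le> b\<close>, of T y] S_def)
    also have "l * (b + 1) = 1/2" using \<open>0 \<le> b\<close> by (simp add: l_def)
    also have "y + (1/2) *\<^sub>R (S y - y) = (1/2) *\<^sub>R y + (1/2) *\<^sub>R S y"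
      using scaleR_add_left[of "1/2" "1/2" y] by (simp add: algebra_simps)
    finally show ?thesis .
  qed
  have "\<exists>p\<in>Fix_on C T. x \<longlonglongrightarrow> p"
    if "x 0 \<in> C" "\<And>n. x (Suc n) = (1 - l) *\<^sub>R x n + l *\<^sub>R T (x n)" for x
    using averaged_iteration_converges[where x = x, OF assms(2-4) SC S demi nonempty that(1)]
      that(2)
    unfolding iter Fix by blast
  with l nonempty conv show ?thesis unfolding Fix by blast
qed

end
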